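(* Let $\mathbb{F}$ be a field and $d,n$ positive integers. The Hilbert zonotope $\mathcal{H}_n^d$ is a refinement of both the basis polytope $\mathcal{B}(I)$ and the state polyhedron $\mathcal{S}(I)=\mathcal{B}(I)+\mathbb{R}_+^d$ of every $I\in\mathrm{Hilb}_n^d$.
   Context: $\mathrm{Hilb}_n^d$ is the set of ideals $I\subseteq\mathbb{F}[x_1,\dots,x_d]$ with $\dim_{\mathbb{F}}\mathbb{F}[x]/I=n$; $x^v=\prod x_i^{v_i}$. A staircase is a set $\lambda\subseteq\mathbb{N}^d$ such that $u\le v\in\lambda$ (coordinatewise) implies $u\in\lambda$; $V_n^d$ is the union of all $n$-element staircases in $\mathbb{N}^d$. An $n$-subset $\lambda\subset\mathbb{N}^d$ is basic for $I$ if the classes modulo $I$ of $x^v$, $v\in\lambda$, form an $\mathbb{F}$-basis of $\mathbb{F}[x]/I$; $\Gamma(I)$ is the set of $n$-subsets of $V_n^d$ basic for $I$. $\mathcal{B}(I):=\mathrm{conv}\{\sum\lambda:\lambda\in\Gamma(I)\}$ where $\sum\lambda$ is the vector sum of the elements of $\lambda$. For $n\ge2$, $D_n^d$ is the set of primitive elements of $V_n^d-V_n^d=\{u-v:u,v\in V_n^d\}$, where an element is primitive if it is not a nonnegative integer multiple of another element of $V_n^d-V_n^d$ (so $0$ and non-primitive multiples are excluded); $D_1^d:=\{\pm e_1,\dots,\pm e_d\}$. The Hilbert zonotope is $\mathcal{H}_n^d:=\sum_{v\in D_n^d}[0,1]\cdot v\subset\mathbb{R}^d$ (Minkowski sum).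 The (minimizing) normal cone of a face $F$ of a polyhedron $P$ is the set of $w$ whose set of minimizers over $P$ is exactly $F$. A polyhedron $P$ refines a polyhedron $Q$ if the closure of each normal cone of $Q$ is a union of closures of normal cones of $P$. *)

theory Defs
  imports "HOL-Analysis.Analysis" "HOL-Library.Poly_Mapping"
begin

text \<open>
  The index type \<open>'d::finite\<close> plays the role of \<open>{1,\<dots>,d}\<close> with \<open>d = CARD('d) \<ge> 1\<close>. A polynomial over
  \<open>'f\<close> in the variables \<open>x\<^sub>i\<close> (\<open>i :: 'd\<close>) is a finitely supported map from exponent vectors in
  \<open>nat ^ 'd\<close> to coefficients, with the convolution product of \<open>HOL-Library.Poly_Mapping\<close>.
\<close>

type_synonym ('f, 'd) mpoly = "(nat ^ 'd) \<Rightarrow>\<^sub>0 'f"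

definition xpow :: "nat ^ 'd \<Rightarrow> ('f::field, 'd::finite) mpoly" where
  "xpow v = Poly_Mapping.single v 1"

definition const_poly :: "'f \<Rightarrow> ('f::field, 'd::finite) mpoly" where
  "const_poly a = Poly_Mapping.single 0 a"

definition poly_ideal :: "('f::field, 'd::finite) mpoly set \<Rightarrow> bool" where
  "poly_ideal I \<longleftrightarrow> 0 \<in> I \<and> (\<forall>p\<in>I. \<forall>q\<in>I. p + q \<in> I) \<and> (\<forall>p. \<forall>q\<in>I. p * q \<in> I)"

text \<open>
  The classes modulo \<open>I\<close> of the family \<open>b k\<close>, \<open>k \<in> A\<close>, form a finite basis of the quotient vector
  space \<open>\<bbbF>[x]/I\<close>: two polynomials have the same class iff their difference lies in \<open>I\<close>.
\<close>

definition basis_modulo ::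
  "('f::field, 'd::finite) mpoly set \<Rightarrow> 'k set \<Rightarrow> ('k \<Rightarrow> ('f, 'd) mpoly) \<Rightarrow> bool" where
  "basis_modulo I A b \<longleftrightarrow> finite A \<and>
     (\<forall>c. (\<Sum>k\<in>A. const_poly (c k) * b k) \<in> I \<longrightarrow> (\<forall>k\<in>A. c k = 0)) \<and>
     (\<forall>p. \<exists>c. p - (\<Sum>k\<in>A. const_poly (c k) * b k) \<in> I)"

definition quotient_dim_eq :: "('f::field, 'd::finite) mpoly set \<Rightarrow> nat \<Rightarrow> bool" where
  "quotient_dim_eq I n \<longleftrightarrow> (\<exists>b :: nat \<Rightarrow> ('f, 'd) mpoly. basis_modulo I {..<n} b)"

definition Hilb :: "nat \<Rightarrow> ('f::field, 'd::finite) mpoly set set" where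
  "Hilb n = {I. poly_ideal I \<and> quotient_dim_eq I n}"

text \<open>The order on \<open>nat ^ 'd\<close> is the coordinatewise one.\<close>

definition staircase :: "(nat ^ 'd::finite) set \<Rightarrow> bool" where
  "staircase L \<longleftrightarrow> (\<forall>u v. u \<le> v \<and> v \<in> L \<longrightarrow> u \<in> L)"

definition V :: "nat \<Rightarrow> (nat ^ 'd::finite) set" where
  "V n = \<Union>{L. finite L \<and> card L = n \<and> staircase L}"

definition Gamma :: "nat \<Rightarrow> ('f::field, 'd::finite) mpoly set \<Rightarrow> (nat ^ 'd) set set" where
  "Gamma n I = {L. L \<subseteq> V n \<and> finite L \<and> card L = n \<and> basis_modulo I L xpow}"

definition real_vec :: "nat ^ 'd \<Rightarrow> real ^ 'd::finite" where
  "real_vec v = (\<chi> i. real (v $ i))"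

definition basis_polytope :: "nat \<Rightarrow> ('f::field, 'd::finite) mpoly set \<Rightarrow> (real ^ 'd) set" where
  "basis_polytope n I = convex hull {real_vec (\<Sum>v\<in>L. v) | L. L \<in> Gamma n I}"

text \<open>Sums of subsets of \<open>real ^ 'd\<close> are Minkowski sums (\<open>HOL-Library.Set_Algebras\<close>).\<close>

definition state_polyhedron :: "nat \<Rightarrow> ('f::field, 'd::finite) mpoly set \<Rightarrow> (real ^ 'd) set" where
  "state_polyhedron n I = basis_polytope n I + {y. \<forall>i. 0 \<le> y $ i}"

definition V_diff :: "nat \<Rightarrow> (real ^ 'd::finite) set" where
  "V_diff n = {real_vec u - real_vec v | u v. u \<in> V n \<and> v \<in> V n}"

text \<open>
  For \<open>n \<ge> 2\<close> the zero vector is not primitive, since it is \<open>0\<close> times a nonzero element of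
  \<open>V_diff n\<close>.
\<close>

definition primitive_dir :: "nat \<Rightarrow> real ^ 'd::finite \<Rightarrow> bool" where
  "primitive_dir n u \<longleftrightarrow>
     u \<in> V_diff n \<and> \<not> (\<exists>w\<in>V_diff n. w \<noteq> u \<and> (\<exists>k::nat. u = real k *\<^sub>R w))"

definition D :: "nat \<Rightarrow> (real ^ 'd::finite) set" where
  "D n = (if n = 1 then {axis i 1 | i. True} \<union> {- axis i 1 | i. True}
          else {u. primitive_dir n u})"

text \<open>\<open>D n\<close> is finite, since every vector in \<open>V n\<close> has all its coordinates below \<open>n\<close>.\<close>

definition hilbert_zonotope :: "nat \<Rightarrow> (real ^ 'd::finite) set" where
  "hilbert_zonotope n = (\<Sum>v\<in>D n. (\<lambda>t. t *\<^sub>R v) ` {0..1})"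

definition minimizers :: "(real ^ 'd::finite) set \<Rightarrow> real ^ 'd \<Rightarrow> (real ^ 'd) set" where
  "minimizers P w = {x \<in> P. \<forall>y\<in>P. w \<bullet> x \<le> w \<bullet> y}"

definition normal_cone :: "(real ^ 'd::finite) set \<Rightarrow> (real ^ 'd) set \<Rightarrow> (real ^ 'd) set" where
  "normal_cone P F = {w. minimizers P w = F}"

text \<open>
  Normal cones are those of nonempty faces. The empty face must be excluded: for an unbounded
  polyhedron, \<open>normal_cone P {}\<close> consists of the functionals that are unbounded below on \<open>P\<close>.
\<close>

definition normal_cones :: "(real ^ 'd::finite) set \<Rightarrow> (real ^ 'd) set set" where
  "normal_cones P = {normal_cone P F | F. F face_of P \<and> F \<noteq> {}}"

definition polyhedron_refines :: "(real ^ 'd::finite) set \<Rightarrow> (real ^ 'd) set \<Rightarrow> bool" where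
  "polyhedron_refines P Q \<longleftrightarrow>
     (\<forall>C\<in>normal_cones Q. \<exists>\<C>\<subseteq>normal_cones P. closure C = (\<Union>K\<in>\<C>. closure K))"

end

theory Submission
  imports Defs
begin

text \<open>
  The face of the zonotope minimizing \<open>w\<close> determines the signs of \<open>w \<bullet> v\<close> for \<open>v \<in> D n\<close>, hence the
  preorder that \<open>w\<close> induces on \<open>V n\<close>. The sets in \<open>Gamma n I\<close> are the bases of a matroid on \<open>V n\<close>, so
  which of them have minimal \<open>w\<close>-weight depends only on this preorder. The summand
  \<open>\<real>\<^sub>+\<^sup>d\<close> of the state polyhedron only adds the signs of the coordinates of \<open>w\<close>, and the
  coordinate directions belong to the differences of \<open>V n\<close>. Therefore every normal cone of either
  polyhedron is a union of finitely many normal cones of the zonotope.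
\<close>

section \<open>Minimizers and Minkowski sums\<close>

lemma minimizers_set_plus:
  "minimizers (A + B) w = minimizers A w + minimizers B w"
proof
  show "minimizers (A + B) w \<subseteq> minimizers A w + minimizers B w"
  proof
    fix x assume x: "x \<in> minimizers (A + B) w"
    then obtain a b where ab: "x = a + b" "a \<in> A" "b \<in> B"
      by (auto simp: minimizers_def elim: set_plus_elim)
    have le: "w \<bullet> (a + b) \<le> w \<bullet> (a' + b')" if "a' \<in> A" "b' \<in> B" for a' b'
      using x ab that by (auto simp: minimizers_def)
    have "w \<bullet> a \<le> w \<bullet> a'" if "a' \<in> A" for a'
      using le[OF that ab(3)] by (simp add: inner_add_right)
    moreover have "w \<bullet> b \<le> w \<bullet> b'" if "b' \<in> B" for b'
      using le[OF ab(2) that] by (simp add: inner_add_right)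
    ultimately show "x \<in> minimizers A w + minimizers B w"
      using ab by (auto simp: minimizers_def)
  qed
  show "minimizers A w + minimizers B w \<subseteq> minimizers (A + B) w"
    by (auto simp: minimizers_def inner_add_right intro!: add_mono elim!: set_plus_elim)
qed

text \<open>Changing a single entry of the decomposition \<open>x\<close> stays inside the Minkowski
  sum, so optimality of the total forces optimality of each summand. Fixing \<open>x\<close> lets
  one point of the zonotope reveal what happens on every segment.\<close>

lemma sum_mem_minimizers_iff:
  assumes "finite A" and "\<forall>v\<in>A. x v \<in> S v"
  shows "sum x A \<in> minimizers (sum S A) w \<longleftrightarrow> (\<forall>v\<in>A. x v \<in> minimizers (S v) w)"
proof
  assume L: "sum x A \<in> minimizers (sum S A) w"
  show "\<forall>v\<in>A. x v \<in> minimizers (S v) w"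
  proof
    fix v assume v: "v \<in> A"
    have "w \<bullet> x v \<le> w \<bullet> y" if y: "y \<in> S v" for y
    proof -
      have "sum (x(v := y)) A \<in> sum S A"
        using assms y by (auto simp: set_sum_alt)
      then have "w \<bullet> sum x A \<le> w \<bullet> sum (x(v := y)) A"
        using L by (auto simp: minimizers_def)
      moreover have "sum (x(v := y)) A = y + sum x (A - {v})"
        using assms(1) v by (subst sum.remove[of _ v]) (auto intro!: sum.cong)
      moreover have "sum x A = x v + sum x (A - {v})"
        using assms(1) v by (rule sum.remove)
      ultimately show ?thesis by (simp add: inner_add_right)
    qed
    then show "x v \<in> minimizers (S v) w"
      using assms v by (auto simp: minimizers_def)
  qed
next
  assume "\<forall>v\<in>A. x v \<in> minimizers (S v) w"
  then show "sum x A \<in> minimizers (sum S A) w"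
    using assms
    by (auto simp: minimizers_def set_sum_alt inner_sum_right intro!: sum_mono)
qed

lemma minimizers_face_of:
  assumes "convex P"
  shows "minimizers P w face_of P"
proof (cases "minimizers P w = {}")
  case False
  then obtain x where x: "x \<in> P" "\<And>y. y \<in> P \<Longrightarrow> w \<bullet> x \<le> w \<bullet> y"
    by (auto simp: minimizers_def)
  have "minimizers P w = P \<inter> {y. w \<bullet> y = w \<bullet> x}"
    using x unfolding minimizers_def by (auto intro!: order.antisym)
  then show ?thesis
    using face_of_Int_supporting_hyperplane_ge[OF assms x(2)] by simp
qed simp

text \<open>The minimizers form a face of the hull, hence the hull of some \<open>T\<close> inside
  \<open>S\<close>, and the points of \<open>T\<close> already minimize over \<open>S\<close>.
  Conversely, a minimizer over \<open>S\<close> puts all of \<open>S\<close>, and so its hull, into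
  a halfspace.\<close>

lemma minimizers_convex_hull:
  assumes "finite S"
  shows "minimizers (convex hull S) w = convex hull (minimizers S w)"
proof
  have "minimizers (convex hull S) w face_of convex hull S"
    by (simp add: minimizers_face_of)
  then obtain T where T: "T \<subseteq> S" "minimizers (convex hull S) w = convex hull T"
    using face_of_convex_hull_subset[OF finite_imp_compact[OF assms]] by blast
  have "T \<subseteq> minimizers S w"
  proof
    fix t assume t: "t \<in> T"
    then have "t \<in> minimizers (convex hull S) w" using T by (simp add: hull_inc)
    then show "t \<in> minimizers S w"
      using T t by (auto simp: minimizers_def hull_inc)
  qed
  then show "minimizers (convex hull S) w \<subseteq> convex hull (minimizers S w)"
    by (simp add: T hull_mono)
next
  have "minimizers S w \<subseteq> minimizers (convex hull S) w"
  proof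
    fix x assume x: "x \<in> minimizers S w"
    then have "S \<subseteq> {y. w \<bullet> x \<le> w \<bullet> y}" by (auto simp: minimizers_def)
    then have "convex hull S \<subseteq> {y. w \<bullet> x \<le> w \<bullet> y}"
      using convex_halfspace_ge[of "w \<bullet> x" w] by (intro hull_minimal) auto
    then show "x \<in> minimizers (convex hull S) w"
      using x by (auto simp: minimizers_def hull_inc)
  qed
  moreover have "convex (minimizers (convex hull S) w)"
    by (rule face_of_imp_convex[OF minimizers_face_of]) simp
  ultimately show "convex hull (minimizers S w) \<subseteq> minimizers (convex hull S) w"
    by (rule hull_minimal)
qed

lemma minimizers_nonempty:
  assumes "compact P" "P \<noteq> {}"
  shows "minimizers P w \<noteq> {}"
proof -
  have "continuous_on P (\<lambda>x. w \<bullet> x)" by (intro continuous_intros)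
  from continuous_attains_inf[OF assms this] show ?thesis
    by (auto simp: minimizers_def)
qed

text \<open>The face of the orthant depends only on the signs of the coordinates: it is empty if
  some coordinate of \<open>w\<close> is negative, and otherwise it is cut out by complementary
  slackness. The two hypotheses together also carry zero coordinates of \<open>w\<close> to zero
  coordinates of \<open>w'\<close>.\<close>

lemma minimizers_orthant_mono:
  fixes w w' :: "real ^ 'd::finite"
  assumes "\<And>i. 0 \<le> w $ i \<Longrightarrow> 0 \<le> w' $ i" and "\<And>i. w $ i \<le> 0 \<Longrightarrow> w' $ i \<le> 0"
  shows "minimizers {y. \<forall>i. 0 \<le> y $ i} w \<subseteq> minimizers {y. \<forall>i. 0 \<le> y $ i} w'"
proof
  fix x assume "x \<in> minimizers {y. \<forall>i. 0 \<le> y $ i} w"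
  then have x: "\<And>i. 0 \<le> x $ i"
    and min: "\<And>y. (\<And>i. 0 \<le> y $ i) \<Longrightarrow> w \<bullet> x \<le> w \<bullet> y"
    by (auto simp: minimizers_def)
  \<comment> \<open>Moving away from \<open>x\<close> along a coordinate axis never leaves the
    orthant.\<close>
  have w: "0 \<le> w $ i" for i
    using min[of "x + axis i 1"] x
    by (simp add: inner_add_right inner_axis) (simp add: axis_def)
  have zero: "w' $ i * x $ i = 0" for i
  proof (cases "w $ i > 0")
    case True
    \<comment> \<open>The competitor is \<open>x\<close> with its coordinate \<open>i\<close> set to
      zero.\<close>
    have "w \<bullet> x \<le> w \<bullet> (x - axis i (x $ i))"
      using x by (intro min) (simp add: axis_def)
    then have "w $ i * x $ i \<le> 0"
      by (simp add: inner_diff_right inner_axis)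
    then show ?thesis
      using True x[of i] by (auto simp: mult_le_0_iff)
  next
    case False
    then have "w' $ i = 0" using assms[of i] w[of i] by linarith
    then show ?thesis by simp
  qed
  have "w' \<bullet> x = 0"
    unfolding inner_vec_def using zero by (intro sum.neutral) simp
  then have "w' \<bullet> x \<le> w' \<bullet> y" if "\<forall>i. 0 \<le> y $ i" for y
    using that assms(1) w by (simp add: inner_vec_def sum_nonneg)
  then show "x \<in> minimizers {y. \<forall>i. 0 \<le> y $ i} w'"
    using x by (simp add: minimizers_def)
qed

section \<open>A criterion for refinement\<close>

text \<open>By \<open>mono\<close>, functionals with the same face of \<open>P\<close> have the same
  face of \<open>Q\<close>, so a normal cone of \<open>Q\<close> is a union of normal cones of
  \<open>P\<close>. A polytope has finitely many faces, so closure commutes with this union.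
  Compactness of \<open>P\<close> makes all faces that occur nonempty, as
  \<open>normal_cones\<close> demands.\<close>

lemma polyhedron_refinesI:
  fixes P Q :: "(real ^ 'd::finite) set"
  assumes P: "polytope P" "P \<noteq> {}"
    and mono: "\<And>w w'. minimizers P w \<subseteq> minimizers P w' \<Longrightarrow> minimizers Q w \<subseteq> minimizers Q w'"
  shows "polyhedron_refines P Q"
  unfolding polyhedron_refines_def
proof
  fix C assume "C \<in> normal_cones Q"
  then obtain F where C: "C = normal_cone Q F" by (auto simp: normal_cones_def)
  define K where "K = (\<lambda>w. normal_cone P (minimizers P w)) ` C"
  have face: "minimizers P w face_of P" for w
    using P by (simp add: minimizers_face_of polytope_imp_convex)
  have "K \<subseteq> normal_cone P ` {F. F face_of P}"
    using face by (auto simp: K_def)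
  then have fin: "finite K"
    using finite_polytope_faces[OF P(1)] finite_surj by blast
  have "K \<subseteq> normal_cones P"
    using face minimizers_nonempty[OF polytope_imp_compact[OF P(1)] P(2)]
    unfolding K_def normal_cones_def by blast
  moreover have "C = \<Union>K"
  proof
    show "C \<subseteq> \<Union>K" by (auto simp: K_def normal_cone_def)
    show "\<Union>K \<subseteq> C"
    proof
      fix u assume "u \<in> \<Union>K"
      then obtain w where "minimizers Q w = F" "minimizers P u = minimizers P w"
        by (auto simp: K_def normal_cone_def C)
      \<comment> \<open>Inclusion in both directions turns equality of the faces of \<open>P\<close>
        into equality of the faces of \<open>Q\<close>.\<close>
      then show "u \<in> C" using mono[of u w] mono[of w u] by (simp add: C normal_cone_def)
    qed
  qed
  then have "closure C = (\<Union>k\<in>K. closure k)"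
    using closure_of_Union[OF fin, of euclidean] by simp
  ultimately show "\<exists>\<C>\<subseteq>normal_cones P. closure C = (\<Union>K\<in>\<C>. closure K)" by blast
qed

section \<open>Basis exchange\<close>

lemma const_poly_simps:
  "const_poly (a + b) = const_poly a + const_poly b"
  "const_poly (a - b) = const_poly a - const_poly b"
  "const_poly (a * b) = const_poly a * const_poly b"
  "const_poly 0 = 0" "const_poly 1 = 1"
  by (simp_all add: const_poly_def single_add single_diff mult_single)

lemma lincomb_simps:
  "(\<Sum>z\<in>L. const_poly (f z + g z) * b z) = (\<Sum>z\<in>L. const_poly (f z) * b z) + (\<Sum>z\<in>L. const_poly (g z) * b z)"
  "(\<Sum>z\<in>L. const_poly (f z - g z) * b z) = (\<Sum>z\<in>L. const_poly (f z) * b z) - (\<Sum>z\<in>L. const_poly (g z) * b z)"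
  "(\<Sum>z\<in>L. const_poly (s * g z) * b z) = const_poly s * (\<Sum>z\<in>L. const_poly (g z) * b z)"
  by (simp_all only: const_poly_simps distrib_right left_diff_distrib sum.distrib sum_subtractf
      mult.assoc sum_distrib_left)

lemma poly_ideal_diff:
  assumes "poly_ideal I" "p \<in> I" "q \<in> I"
  shows "p - q \<in> I"
proof -
  have "- 1 * q \<in> I" using assms unfolding poly_ideal_def by blast
  then have "p + - 1 * q \<in> I" using assms unfolding poly_ideal_def by blast
  then show ?thesis by simp
qed

lemma poly_ideal_sum:
  assumes "poly_ideal I" "finite A" "\<And>k. k \<in> A \<Longrightarrow> f k \<in> I"
  shows "sum f A \<in> I"
  using assms(2,3) by induction (use assms(1) in \<open>auto simp: poly_ideal_def\<close>)

text \<open>Since \<open>a k\<close> is invertible, the expansion of \<open>b j\<close> can be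
  solved for \<open>b k\<close> modulo \<open>I\<close>.\<close>

lemma basis_modulo_exchange:
  fixes I :: "('f::field, 'd::finite) mpoly set" and b :: "'k \<Rightarrow> ('f, 'd) mpoly"
  assumes I: "poly_ideal I" and L: "basis_modulo I L b"
    and k: "k \<in> L" and j: "j \<notin> L"
    and a: "b j - (\<Sum>z\<in>L. const_poly (a z) * b z) \<in> I" and ak: "a k \<noteq> 0"
  shows "basis_modulo I (insert j (L - {k})) b"
proof -
  have fin: "finite L"
    and ind: "\<And>c. (\<Sum>z\<in>L. const_poly (c z) * b z) \<in> I \<Longrightarrow> \<forall>z\<in>L. c z = 0"
    and span: "\<And>p. \<exists>c. p - (\<Sum>z\<in>L. const_poly (c z) * b z) \<in> I"
    using L unfolding basis_modulo_def by blast+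
  let ?M = "insert j (L - {k})" and ?r = "b j - (\<Sum>z\<in>L. const_poly (a z) * b z)"
  have mult: "p * q \<in> I" if "q \<in> I" for p q
    using I that unfolding poly_ideal_def by blast
  have sumM: "(\<Sum>z\<in>?M. f z) = f j + (\<Sum>z\<in>L. f z) - f k" for f :: "'k \<Rightarrow> ('f, 'd) mpoly"
    using fin j by (simp add: sum.remove[OF fin k])
  have "\<forall>z\<in>?M. c z = 0" if c: "(\<Sum>z\<in>?M. const_poly (c z) * b z) \<in> I" for c
  proof -
    \<comment> \<open>The value \<open>c k\<close> is arbitrary because \<open>k\<close> is outside
      \<open>?M\<close>. Substituting the expansion of \<open>b j\<close> gives a relation over
      \<open>L\<close> whose coefficient at \<open>k\<close> is only
      \<open>c j * a k\<close>.\<close>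
    define e where "e = c(k := 0)"
    have e: "(\<Sum>z\<in>L. const_poly (e z) * b z) = (\<Sum>z\<in>L. const_poly (c z) * b z) - const_poly (c k) * b k"
      by (simp add: e_def sum.remove[OF fin k] const_poly_simps)
    have "(\<Sum>z\<in>L. const_poly (e z + c j * a z) * b z)
        = (\<Sum>z\<in>?M. const_poly (c z) * b z) - const_poly (c j) * ?r"
      unfolding sumM lincomb_simps e by (simp add: right_diff_distrib)
    also have "\<dots> \<in> I" using poly_ideal_diff[OF I c mult[OF a]] .
    finally have *: "\<forall>z\<in>L. e z + c j * a z = 0" by (rule ind)
    then have "e k + c j * a k = 0" using k by blast
    then have "c j = 0" using ak by (simp add: e_def)
    then show ?thesis using * by (auto simp: e_def split: if_splits)
  qed
  moreover have "\<exists>c. p - (\<Sum>z\<in>?M. const_poly (c z) * b z) \<in> I" for p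
  proof -
    obtain c where c: "p - (\<Sum>z\<in>L. const_poly (c z) * b z) \<in> I" using span by blast
    \<comment> \<open>\<open>s\<close> is the multiple of \<open>b j\<close> that absorbs the term
      of \<open>b k\<close>: subtracting \<open>s\<close> times the expansion of \<open>b j\<close>
      cancels the coefficient at \<open>k\<close>.\<close>
    define s where "s = c k / a k"
    define e where "e = (\<lambda>z. if z = j then s else c z - s * a z)"
    have sk: "c k - s * a k = 0" using ak by (simp add: s_def)
    have "e k = 0" using sk k j by (auto simp: e_def)
    have "(\<Sum>z\<in>L. const_poly (e z) * b z) = (\<Sum>z\<in>L. const_poly (c z - s * a z) * b z)"
      using j by (intro sum.cong) (auto simp: e_def)
    also have "\<dots> = (\<Sum>z\<in>L. const_poly (c z) * b z) - const_poly s * (\<Sum>z\<in>L. const_poly (a z) * b z)"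
      by (simp only: lincomb_simps)
    finally have "p - (\<Sum>z\<in>?M. const_poly (e z) * b z)
        = (p - (\<Sum>z\<in>L. const_poly (c z) * b z)) - const_poly s * ?r"
      unfolding sumM using \<open>e k = 0\<close>
      by (simp add: const_poly_simps right_diff_distrib) (simp add: e_def)
    also have "\<dots> \<in> I" using poly_ideal_diff[OF I c mult[OF a]] .
    finally show ?thesis by blast
  qed
  ultimately show ?thesis using fin by (simp add: basis_modulo_def del: sum.insert)
qed

text \<open>
  Expand \<open>b x\<close> in the basis \<open>M\<close> and then each \<open>b y\<close>, \<open>y \<in> M\<close>, in the basis \<open>L\<close>: the coefficient of
  \<open>b x\<close> in the result is 1, so some \<open>y\<close> contributes a nonzero product, and both factors of that
  product permit an exchange.
\<close>

lemma basis_modulo_symmetric_exchange: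
  fixes I :: "('f::field, 'd::finite) mpoly set" and b :: "'k \<Rightarrow> ('f, 'd) mpoly"
  assumes I: "poly_ideal I" and L: "basis_modulo I L b" and M: "basis_modulo I M b"
    and x: "x \<in> L" "x \<notin> M"
  obtains y where "y \<in> M" "y \<notin> L"
    "basis_modulo I (insert y (L - {x})) b" "basis_modulo I (insert x (M - {y})) b"
proof -
  have fin: "finite L" "finite M"
    and ind: "\<And>c. (\<Sum>z\<in>L. const_poly (c z) * b z) \<in> I \<Longrightarrow> \<forall>z\<in>L. c z = 0"
    using L M unfolding basis_modulo_def by blast+
  obtain c where c: "b x - (\<Sum>y\<in>M. const_poly (c y) * b y) \<in> I"
    using M unfolding basis_modulo_def by blast
  have "\<forall>y. \<exists>c. b y - (\<Sum>z\<in>L. const_poly (c z) * b z) \<in> I"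
    using L unfolding basis_modulo_def by blast
  from choice[OF this] obtain a where a: "\<And>y. b y - (\<Sum>z\<in>L. const_poly (a y z) * b z) \<in> I" by blast
  \<comment> \<open>The coefficients \<open>a y\<close> come from a choice; independence of
    \<open>L\<close> forces them to be a unit vector on \<open>L\<close> when \<open>y\<close> lies
    in \<open>L\<close>.\<close>
  have in_L: "(if z = y then 1 else 0) = a y z" if "y \<in> L" "z \<in> L" for y z
  proof -
    have "(\<Sum>z\<in>L. const_poly ((if z = y then 1 else 0) - a y z) * b z)
        = (\<Sum>z\<in>L. const_poly (if z = y then 1 else 0) * b z) - (\<Sum>z\<in>L. const_poly (a y z) * b z)"
      by (rule lincomb_simps)
    also have "(\<Sum>z\<in>L. const_poly (if z = y then 1 else 0) * b z) = (\<Sum>z\<in>L. if z = y then b z else 0)"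
      by (intro sum.cong) (auto simp: const_poly_simps)
    also have "\<dots> = b y" using fin that by simp
    also have "b y - (\<Sum>z\<in>L. const_poly (a y z) * b z) \<in> I" by (rule a)
    finally show ?thesis using ind[of "\<lambda>z. (if z = y then 1 else 0) - a y z"] that by auto
  qed
  \<comment> \<open>The direct expansion of \<open>b x\<close> in \<open>L\<close> and the one
    through \<open>M\<close> are congruent modulo \<open>I\<close>, so independence of
    \<open>L\<close> will equate their coefficients at \<open>x\<close>.\<close>
  have "(\<Sum>z\<in>L. const_poly (a x z - (\<Sum>y\<in>M. c y * a y z)) * b z)
      = (\<Sum>z\<in>L. const_poly (a x z) * b z) - (\<Sum>y\<in>M. const_poly (c y) * (\<Sum>z\<in>L. const_poly (a y z) * b z))"
  proof -
    have cs: "const_poly (sum f M) = (\<Sum>y\<in>M. const_poly (f y))" for f :: "'k \<Rightarrow> 'f"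
      using fin(2) by induction (auto simp: const_poly_simps)
    have "(\<Sum>z\<in>L. const_poly (\<Sum>y\<in>M. c y * a y z) * b z)
       = (\<Sum>z\<in>L. \<Sum>y\<in>M. const_poly (c y) * (const_poly (a y z) * b z))"
      by (simp add: cs const_poly_simps sum_distrib_right mult.assoc)
    also have "\<dots> = (\<Sum>y\<in>M. const_poly (c y) * (\<Sum>z\<in>L. const_poly (a y z) * b z))"
      by (subst sum.swap) (simp add: sum_distrib_left)
    finally show ?thesis
      unfolding lincomb_simps(2) by simp
  qed
  also have "\<dots> = (b x - (\<Sum>y\<in>M. const_poly (c y) * b y))
      + (\<Sum>y\<in>M. const_poly (c y) * (b y - (\<Sum>z\<in>L. const_poly (a y z) * b z)))
      - (b x - (\<Sum>z\<in>L. const_poly (a x z) * b z))"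
    by (simp add: right_diff_distrib sum_subtractf)
  also have "\<dots> \<in> I"
  proof (rule poly_ideal_diff[OF I _ a])
    have "(\<Sum>y\<in>M. const_poly (c y) * (b y - (\<Sum>z\<in>L. const_poly (a y z) * b z))) \<in> I"
      using I a by (intro poly_ideal_sum[OF I fin(2)]) (auto simp: poly_ideal_def)
    then show "b x - (\<Sum>y\<in>M. const_poly (c y) * b y) +
      (\<Sum>y\<in>M. const_poly (c y) * (b y - (\<Sum>z\<in>L. const_poly (a y z) * b z))) \<in> I"
      using I c unfolding poly_ideal_def by blast
  qed
  finally have "a x x - (\<Sum>y\<in>M. c y * a y x) = 0"
    using ind[of "\<lambda>z. a x z - (\<Sum>y\<in>M. c y * a y z)"] x by blast
  then have "(\<Sum>y\<in>M. c y * a y x) \<noteq> 0" using in_L[of x x] x by auto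
  then obtain y where y: "y \<in> M" "c y * a y x \<noteq> 0" by (meson sum.neutral)
  have "y \<notin> L"
  proof
    assume "y \<in> L"
    moreover have "x \<noteq> y" using x y by blast
    ultimately have "a y x = 0" using in_L[of y x] x by simp
    then show False using y by simp
  qed
  show thesis
  proof (rule that[OF y(1) \<open>y \<notin> L\<close>])
    show "basis_modulo I (insert y (L - {x})) b"
      using basis_modulo_exchange[OF I L x(1) \<open>y \<notin> L\<close> a] y by simp
    show "basis_modulo I (insert x (M - {y})) b"
      using basis_modulo_exchange[OF I M y(1) x(2) c] y by simp
  qed
qed

text \<open>An exchange only uses elements of \<open>L\<close> and \<open>M\<close>, so the
  restriction to subsets of \<open>V n\<close> survives, and the cardinality is kept.\<close>

lemma Gamma_exchange:
  assumes I: "poly_ideal I" and "L \<in> Gamma n I" "M \<in> Gamma n I" "x \<in> L - M"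
  shows "\<exists>y\<in>M - L. insert y (L - {x}) \<in> Gamma n I \<and> insert x (M - {y}) \<in> Gamma n I"
proof -
  have L: "L \<subseteq> V n" "finite L" "card L = n" "basis_modulo I L xpow"
    and M: "M \<subseteq> V n" "finite M" "card M = n" "basis_modulo I M xpow"
    and x: "x \<in> L" "x \<notin> M"
    using assms by (auto simp: Gamma_def)
  obtain y where y: "y \<in> M" "y \<notin> L"
    "basis_modulo I (insert y (L - {x})) xpow" "basis_modulo I (insert x (M - {y})) xpow"
    using basis_modulo_symmetric_exchange[OF I L(4) M(4) x] .
  have "card (insert y (L - {x})) = n" "card (insert x (M - {y})) = n"
    using L(2,3) M(2,3) x y(1,2) card_Suc_Diff1[of L x] card_Suc_Diff1[of M y] by simp_all
  then show ?thesis using L M x y by (auto simp: Gamma_def intro!: bexI[of _ y])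
qed

text \<open>
  Local optimality of \<open>L\<close> only involves comparisons between two elements, and symmetric exchange
  moves \<open>M\<close> towards \<open>L\<close> without increasing its weight.
\<close>

lemma exchange_minimal_mono:
  fixes f g :: "'a \<Rightarrow> real"
  assumes fin: "\<And>L. L \<in> B \<Longrightarrow> finite L"
    and exchange: "\<And>L M x. L \<in> B \<Longrightarrow> M \<in> B \<Longrightarrow> x \<in> L - M \<Longrightarrow>
      \<exists>y\<in>M - L. insert y (L - {x}) \<in> B \<and> insert x (M - {y}) \<in> B"
    and order: "\<And>x y. x \<in> \<Union>B \<Longrightarrow> y \<in> \<Union>B \<Longrightarrow> f x \<le> f y \<Longrightarrow> g x \<le> g y"
    and L: "L \<in> B" "\<And>M. M \<in> B \<Longrightarrow> sum f L \<le> sum f M"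
    and M: "M \<in> B"
  shows "sum g L \<le> sum g M"
  using M
proof (induction "card (L - M)" arbitrary: M rule: less_induct)
  case less
  have swap: "sum h (insert y (N - {x})) = sum h N - h x + h y"
    if "N \<in> B" "x \<in> N" "y \<notin> N" for h :: "'a \<Rightarrow> real" and N x y
    using fin[OF that(1)] that by (simp add: sum_diff1)
  show ?case
  proof (cases "L \<subseteq> M")
    case True
    \<comment> \<open>An element of \<open>M - L\<close> would have to be exchanged for an element
      of the empty set \<open>L - M\<close>.\<close>
    then have "L = M" using exchange[OF less.prems L(1)] by blast
    then show ?thesis by simp
  next
    case False
    then obtain x where x: "x \<in> L" "x \<notin> M" by blast
    then obtain y where y: "y \<in> M" "y \<notin> L" "insert y (L - {x}) \<in> B" "insert x (M - {y}) \<in> B"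
      using exchange[OF L(1) less.prems] by blast
    \<comment> \<open>Minimality of \<open>L\<close> is used only against its own exchange; the
      other exchanged set is where the induction continues.\<close>
    have "f x \<le> f y" using L(2)[OF y(3)] swap[OF L(1) x(1) y(2)] by simp
    then have le: "g x \<le> g y" using x y L(1) less.prems by (intro order) auto
    have "L - insert x (M - {y}) = (L - M) - {x}" using y by auto
    then have "card (L - insert x (M - {y})) < card (L - M)"
      using x fin[OF L(1)] by (metis Diff_iff card_Diff1_less finite_Diff)
    then have "sum g L \<le> sum g (insert x (M - {y}))" using y(4) by (rule less.hyps)
    then show ?thesis using swap[OF less.prems y(1) x(2), of g] le by simp
  qed
qed

section \<open>The directions of the zonotope\<close>

text \<open>Lowering coordinate \<open>i\<close> of \<open>v\<close> to each of
  \<open>0, ..., v $ i\<close> gives \<open>v $ i + 1\<close> distinct elements of any staircase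
  containing \<open>v\<close>.\<close>

lemma V_coordinate_less:
  assumes "v \<in> V n"
  shows "v $ i < n"
proof -
  obtain L where L: "finite L" "card L = n" "staircase L" "v \<in> L"
    using assms by (auto simp: V_def)
  let ?f = "\<lambda>k. (\<chi> j. if j = i then k else v $ j)"
  have "?f ` {..v $ i} \<subseteq> L"
  proof
    fix u assume "u \<in> ?f ` {..v $ i}"
    then have "u \<le> v" by (auto simp: less_eq_vec_def)
    then show "u \<in> L" using L unfolding staircase_def by blast
  qed
  then have "card (?f ` {..v $ i}) \<le> n" using L card_mono by blast
  moreover have "inj_on ?f {..v $ i}"
    by (auto simp: inj_on_def vec_eq_iff split: if_splits)
  ultimately show ?thesis by (simp add: card_image)
qed

lemma finite_V: "finite (V n :: (nat ^ 'd::finite) set)"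
proof (rule finite_subset)
  show "(V n :: (nat ^ 'd) set) \<subseteq> vec_lambda ` (PiE UNIV (\<lambda>_. {..<n}))"
  proof
    fix v :: "nat ^ 'd" assume "v \<in> V n"
    then show "v \<in> vec_lambda ` (PiE UNIV (\<lambda>_. {..<n}))"
      by (intro image_eqI[of _ _ "vec_nth v"]) (auto simp: V_coordinate_less)
  qed
  show "finite (vec_lambda ` (PiE (UNIV :: 'd set) (\<lambda>_. {..<n})))"
    by (intro finite_imageI finite_PiE) auto
qed

lemma finite_V_diff: "finite (V_diff n :: (real ^ 'd::finite) set)"
proof -
  have "V_diff n = (\<lambda>(u, v). real_vec u - real_vec v) ` (V n \<times> (V n :: (nat ^ 'd) set))"
    by (auto simp: V_diff_def)
  then show ?thesis by (simp add: finite_V)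
qed

lemma finite_D: "finite (D n :: (real ^ 'd::finite) set)"
proof (cases "n = 1")
  case True
  then show ?thesis by (simp add: D_def full_SetCompr_eq)
next
  case False
  then show ?thesis
    by (auto simp: D_def primitive_dir_def intro: finite_subset[OF _ finite_V_diff])
qed

text \<open>The first \<open>n\<close> lattice points on the \<open>i\<close>-th axis form a
  staircase, which contains the origin and the unit vector once \<open>n\<close> is at least
  2.\<close>

lemma axis_mem_V_diff:
  fixes i :: "'d::finite"
  assumes "n \<ge> 2"
  shows "axis i 1 \<in> V_diff n" "- axis i 1 \<in> V_diff n"
proof -
  let ?L = "axis i ` {..<n} :: (nat ^ 'd) set"
  have "inj_on (axis i :: nat \<Rightarrow> nat ^ 'd) {..<n}" by (auto simp: inj_on_def axis_eq_axis)
  then have "card ?L = n" by (simp add: card_image)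
  moreover have "staircase ?L"
    unfolding staircase_def
  proof (intro allI impI)
    fix u v :: "nat ^ 'd" assume "u \<le> v \<and> v \<in> ?L"
    then obtain k where k: "k < n" and le: "\<And>j. u $ j \<le> axis i k $ j"
      by (auto simp: less_eq_vec_def)
    have "u = axis i (u $ i)"
      using le by (auto simp: vec_eq_iff axis_def split: if_splits) (metis le_zero_eq)
    moreover have "u $ i < n" using le[of i] k by (simp add: axis_def)
    ultimately show "u \<in> ?L" by blast
  qed
  ultimately have "?L \<subseteq> V n" by (auto simp: V_def)
  then have "axis i 0 \<in> (V n :: (nat ^ 'd) set)" "axis i 1 \<in> (V n :: (nat ^ 'd) set)"
    using assms by auto
  moreover have "real_vec (axis i 1 :: nat ^ 'd) - real_vec (axis i 0) = axis i 1"
    "real_vec (axis i 0 :: nat ^ 'd) - real_vec (axis i 1) = - axis i 1"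
    by (auto simp: real_vec_def axis_def vec_eq_iff)
  ultimately show "axis i 1 \<in> V_diff n" "- axis i 1 \<in> V_diff n"
    unfolding V_diff_def by (metis (mono_tags, lifting) mem_Collect_eq)+
qed

text \<open>A nonzero vector that is not primitive is a multiple of a strictly shorter one, and
  \<open>V_diff n\<close> is finite; the induction counts the shorter elements.\<close>

lemma multiple_of_primitive:
  fixes u :: "real ^ 'd::finite"
  assumes "u \<in> V_diff n" "u \<noteq> 0"
  shows "\<exists>w k. primitive_dir n w \<and> u = real k *\<^sub>R w"
  using assms
proof (induction "card {x \<in> V_diff n :: (real ^ 'd) set. norm x < norm u}" arbitrary: u rule: less_induct)
  case (less u)
  let ?N = "\<lambda>r. {x \<in> V_diff n :: (real ^ 'd) set. norm x < r}"
  show ?case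
  proof (cases "primitive_dir n u")
    case True
    then show ?thesis by (intro exI[of _ u] exI[of _ 1]) simp
  next
    case False
    then obtain w k where w: "w \<in> V_diff n" "w \<noteq> u" "u = real k *\<^sub>R w"
      using less.prems by (auto simp: primitive_dir_def)
    \<comment> \<open>The factor is thus at least 2, which makes \<open>w\<close> strictly shorter
      than \<open>u\<close>.\<close>
    have "w \<noteq> 0" "k \<noteq> 0" "k \<noteq> 1" using w less.prems by auto
    then have "1 * norm w < real k * norm w" by (intro mult_strict_right_mono) auto
    then have "norm w < norm u" using w by simp
    then have "?N (norm w) \<subset> ?N (norm u)"
      using w(1) by auto
    then have "card (?N (norm w)) < card (?N (norm u))"
      by (intro psubset_card_mono) (simp_all add: finite_V_diff)
    then obtain w' k' where "primitive_dir n w'" "w = real k' *\<^sub>R w'"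
      using less.hyps[OF _ w(1) \<open>w \<noteq> 0\<close>] by blast
    then show ?thesis using w by (intro exI[of _ w'] exI[of _ "k * k'"]) simp
  qed
qed

text \<open>Signs pass from a primitive vector to its positive multiples. For \<open>n = 1\<close>
  there is nothing to transfer, as the only vector in \<open>V n\<close> is the origin.\<close>

lemma nonneg_on_V_diff:
  fixes w w' :: "real ^ 'd::finite"
  assumes D: "\<And>v. v \<in> D n \<Longrightarrow> 0 \<le> w \<bullet> v \<Longrightarrow> 0 \<le> w' \<bullet> v"
    and v: "v \<in> V_diff n" "0 \<le> w \<bullet> v"
  shows "0 \<le> w' \<bullet> v"
proof (cases "n = 1 \<or> v = 0")
  case True
  have "v = 0" if "n = 1"
  proof -
    obtain x y where xy: "v = real_vec x - real_vec y" "x \<in> V n" "y \<in> V n"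
      using v by (auto simp: V_diff_def)
    then have "x = y" using V_coordinate_less[of x n] V_coordinate_less[of y n] that
      by (simp add: vec_eq_iff)
    then show ?thesis using xy by simp
  qed
  then show ?thesis using True by auto
next
  case False
  then obtain u k where u: "primitive_dir n u" "v = real k *\<^sub>R u"
    using multiple_of_primitive[OF v(1)] by blast
  then have "k \<noteq> 0" using False by auto
  then have "0 \<le> w \<bullet> u" using u v by (simp add: zero_le_mult_iff)
  then have "0 \<le> w' \<bullet> u" using u False by (intro D) (auto simp: D_def)
  then show ?thesis using u by simp
qed

text \<open>These are the signs that the orthant summand of the state polyhedron needs. For
  \<open>n = 1\<close> the axis directions are not differences of \<open>V n\<close> but belong to
  \<open>D n\<close> by definition.\<close>

lemma nonneg_on_axis:
  fixes w w' :: "real ^ 'd::finite"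
  assumes "n \<ge> 1" and D: "\<And>v. v \<in> D n \<Longrightarrow> 0 \<le> w \<bullet> v \<Longrightarrow> 0 \<le> w' \<bullet> v"
    and v: "v = axis i 1 \<or> v = - axis i 1" "0 \<le> w \<bullet> v"
  shows "0 \<le> w' \<bullet> v"
proof (cases "n = 1")
  case True
  then show ?thesis using v by (intro D) (auto simp: D_def)
next
  case False
  then show ?thesis
    using v assms(1) axis_mem_V_diff[of n i] nonneg_on_V_diff[of n, OF D] by auto
qed

section \<open>The Hilbert zonotope\<close>

lemma polytope_set_plus: "polytope S \<Longrightarrow> polytope T \<Longrightarrow> polytope (S + T)"
  unfolding polytope_def using convex_hull_set_plus finite_set_plus by metis

lemma polytope_set_sum:
  assumes "finite A" "\<And>v. v \<in> A \<Longrightarrow> polytope (S v)"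
  shows "polytope (sum S A)"
  using assms by induction (simp_all add: polytope_set_plus polytope_sing)

lemma polytope_hilbert_zonotope: "polytope (hilbert_zonotope n)"
  unfolding hilbert_zonotope_def
proof (rule polytope_set_sum[OF finite_D])
  fix v :: "real ^ 'a"
  have "polytope {0..1::real}" using polytope_interval[of "0::real" 1] by simp
  then show "polytope ((\<lambda>t. t *\<^sub>R v) ` {0..1})"
    by (intro polytope_linear_image) (simp add: linear_iff scaleR_add_left)
qed

lemma segment_endpoints:
  fixes v :: "'a::real_vector"
  shows "0 \<in> (\<lambda>t. t *\<^sub>R v) ` {0..1::real}" "v \<in> (\<lambda>t. t *\<^sub>R v) ` {0..1::real}"
  by (rule image_eqI[of _ _ 0]; simp) (rule image_eqI[of _ _ 1]; simp)

lemma hilbert_zonotope_nonempty: "hilbert_zonotope n \<noteq> {}"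
proof -
  have "(\<Sum>v\<in>D n. v) \<in> hilbert_zonotope n"
    unfolding hilbert_zonotope_def set_sum_alt[OF finite_D]
    using segment_endpoints by (intro CollectI exI[of _ "\<lambda>v. v"]) blast
  then show ?thesis by blast
qed

text \<open>One suitable point of the face for \<open>w\<close> suffices: since it also minimizes
  \<open>w'\<close>, its summand on the segment of \<open>v\<close>, namely \<open>0\<close>, does
  so there and can be compared with the endpoint \<open>v\<close>.\<close>

lemma hilbert_zonotope_minimizers_signs:
  fixes w w' :: "real ^ 'd::finite"
  assumes sub: "minimizers (hilbert_zonotope n) w \<subseteq> minimizers (hilbert_zonotope n) w'"
    and v: "v \<in> D n" "0 \<le> w \<bullet> v"
  shows "0 \<le> w' \<bullet> v"
proof -
  define S where "S = (\<lambda>v :: real ^ 'd. (\<lambda>t. t *\<^sub>R v) ` {0..1::real})"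
  \<comment> \<open>On each segment take the endpoint that minimizes \<open>w\<close>, with ties
    resolved in favour of \<open>0\<close>; so the case \<open>w \<bullet> v = 0\<close> is covered
    too.\<close>
  define x where "x = (\<lambda>u. if 0 \<le> w \<bullet> u then 0 else u)"
  have Z: "hilbert_zonotope n = sum S (D n)" by (simp add: hilbert_zonotope_def S_def)
  have x_S: "\<forall>u\<in>D n. x u \<in> S u"
    by (simp add: x_def S_def segment_endpoints)
  have "x u \<in> minimizers (S u) w" for u
  proof (cases "0 \<le> w \<bullet> u")
    case True
    then show ?thesis by (auto simp: x_def S_def minimizers_def segment_endpoints)
  next
    case False
    then have "w \<bullet> u \<le> t * (w \<bullet> u)" if "t \<le> 1" for t
      using mult_right_mono_neg[OF that, of "w \<bullet> u"] by simp
    then show ?thesis using False by (auto simp: x_def S_def minimizers_def segment_endpoints)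
  qed
  then have "sum x (D n) \<in> minimizers (hilbert_zonotope n) w"
    unfolding Z using sum_mem_minimizers_iff[OF finite_D x_S] by blast
  then have "sum x (D n) \<in> minimizers (sum S (D n)) w'" using sub Z by auto
  then have "x v \<in> minimizers (S v) w'"
    using sum_mem_minimizers_iff[OF finite_D x_S] v by blast
  moreover have "v \<in> S v" by (simp add: S_def segment_endpoints)
  ultimately have "w' \<bullet> x v \<le> w' \<bullet> v" by (simp add: minimizers_def)
  then show ?thesis using v by (simp add: x_def)
qed

section \<open>Faces of the basis polytope and the conclusion\<close>

lemma inner_real_vec_sum: "w \<bullet> real_vec (\<Sum>v\<in>L. v) = (\<Sum>v\<in>L. w \<bullet> real_vec v)"
proof -
  have "real_vec (\<Sum>v\<in>L. v) = (\<Sum>v\<in>L. real_vec v)"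
    by (simp add: real_vec_def vec_eq_iff)
  then show ?thesis by (simp add: inner_sum_right)
qed

text \<open>It suffices to compare the generating points, where a functional becomes an additive
  weight on the members of \<open>Gamma n I\<close>. The hypothesis says that the order of weights
  on \<open>V n\<close> under \<open>w\<close> is respected by \<open>w'\<close>, which is what the
  exchange argument requires.\<close>

lemma minimizers_basis_polytope_mono:
  fixes I :: "('f::field, 'd::finite) mpoly set" and w w' :: "real ^ 'd"
  assumes I: "poly_ideal I"
    and V: "\<And>v. v \<in> V_diff n \<Longrightarrow> 0 \<le> w \<bullet> v \<Longrightarrow> 0 \<le> w' \<bullet> v"
  shows "minimizers (basis_polytope n I) w \<subseteq> minimizers (basis_polytope n I) w'"
proof -
  let ?S = "{real_vec (\<Sum>v\<in>L. v) | L. L \<in> Gamma n I}"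
  have "Gamma n I \<subseteq> Pow (V n)" by (auto simp: Gamma_def)
  then have "finite (Gamma n I)" using finite_V finite_subset by blast
  then have fin: "finite ?S" by simp
  have "minimizers ?S w \<subseteq> minimizers ?S w'"
  proof
    fix p assume "p \<in> minimizers ?S w"
    then obtain L where L: "L \<in> Gamma n I" "p = real_vec (\<Sum>v\<in>L. v)"
      and min: "\<And>M. M \<in> Gamma n I \<Longrightarrow> w \<bullet> p \<le> w \<bullet> real_vec (\<Sum>v\<in>M. v)"
      by (auto simp: minimizers_def)
    have "(\<Sum>v\<in>L. w' \<bullet> real_vec v) \<le> (\<Sum>v\<in>M. w' \<bullet> real_vec v)" if M: "M \<in> Gamma n I" for M
    proof (rule exchange_minimal_mono[where B = "Gamma n I" and f = "\<lambda>v. w \<bullet> real_vec v"])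
      show "w' \<bullet> real_vec x \<le> w' \<bullet> real_vec y"
        if "x \<in> \<Union>(Gamma n I)" "y \<in> \<Union>(Gamma n I)" "w \<bullet> real_vec x \<le> w \<bullet> real_vec y" for x y
      proof -
        have "real_vec y - real_vec x \<in> V_diff n"
          using that by (auto simp: V_diff_def Gamma_def)
        from V[OF this] that(3) show ?thesis by (simp add: inner_diff_right)
      qed
      show "(\<Sum>v\<in>L. w \<bullet> real_vec v) \<le> (\<Sum>v\<in>M. w \<bullet> real_vec v)" if "M \<in> Gamma n I" for M
        using min[OF that] L(2) by (simp only: inner_real_vec_sum)
    qed (use Gamma_exchange[OF I] L M in \<open>auto simp: Gamma_def\<close>)
    then have "w' \<bullet> p \<le> w' \<bullet> real_vec (\<Sum>v\<in>M. v)" if "M \<in> Gamma n I" for M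
      using that L(2) by (simp only: inner_real_vec_sum)
    then show "p \<in> minimizers ?S w'" using L by (auto simp: minimizers_def)
  qed
  then show ?thesis
    unfolding basis_polytope_def minimizers_convex_hull[OF fin] by (rule hull_mono)
qed

theorem theorem3p5:
  fixes I :: "('f::field, 'd::finite) mpoly set" and n :: nat
  assumes "n \<ge> 1" and "I \<in> Hilb n"
  shows "polyhedron_refines (hilbert_zonotope n) (basis_polytope n I) \<and>
         polyhedron_refines (hilbert_zonotope n) (state_polyhedron n I)"
proof -
  have I: "poly_ideal I" using assms by (simp add: Hilb_def)
  have basis: "minimizers (basis_polytope n I) w \<subseteq> minimizers (basis_polytope n I) w'"
    and state: "minimizers (state_polyhedron n I) w \<subseteq> minimizers (state_polyhedron n I) w'"
    if sub: "minimizers (hilbert_zonotope n) w \<subseteq> minimizers (hilbert_zonotope n) w'"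
    for w w' :: "real ^ 'd"
  proof -
    note D = hilbert_zonotope_minimizers_signs[OF sub]
    show *: "minimizers (basis_polytope n I) w \<subseteq> minimizers (basis_polytope n I) w'"
      by (intro minimizers_basis_polytope_mono[OF I] nonneg_on_V_diff[OF D])
    have "minimizers {y. \<forall>i. 0 \<le> y $ i} w \<subseteq> minimizers {y. \<forall>i. 0 \<le> y $ i} w'"
    proof (rule minimizers_orthant_mono)
      show "0 \<le> w' $ i" if "0 \<le> w $ i" for i
        using nonneg_on_axis[OF assms(1) D, where v = "axis i 1" and i = i] that by (simp add: inner_axis)
      \<comment> \<open>The upper bound on a coordinate is nonnegativity along the opposite axis
        direction.\<close>
      show "w' $ i \<le> 0" if "w $ i \<le> 0" for i
        using nonneg_on_axis[OF assms(1) D, where v = "- axis i 1" and i = i] that by (simp add: inner_axis)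
    qed
    \<comment> \<open>The face of a Minkowski sum is the sum of the faces, so the two inclusions add
      up.\<close>
    then show "minimizers (state_polyhedron n I) w \<subseteq> minimizers (state_polyhedron n I) w'"
      unfolding state_polyhedron_def minimizers_set_plus by (intro set_plus_mono2 *)
  qed
  show ?thesis
    using basis state
    by (intro conjI polyhedron_refinesI polytope_hilbert_zonotope hilbert_zonotope_nonempty)
qed

end
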